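(* Assume $\mathrm{MA}_\alpha$. Suppose that $\{\mathcal U_i:i<\alpha\}$ is a collection of P-points on $\omega$, that $\mathcal U_0$ is a $P_{\mathfrak c}$-point, and that $\mathcal U_i\le_{RK}\mathcal U_0$ for each $i<\alpha$. Then there is a P-point $\mathcal U$ such that $\mathcal U\le_{RK}\mathcal U_i$ for each $i<\alpha$.
   Context: $\mathfrak c$ is the cardinality of the continuum. $\mathrm{MA}_\alpha$ is the statement: for every partial order $P$ satisfying the countable chain condition and every collection $\{D_i:i<\alpha\}$ of dense subsets of $P$, there is a filter $G\subseteq P$ meeting every $D_i$. For ultrafilters $\mathcal U,\mathcal V$ on $\omega$, $\mathcal U\le_{RK}\mathcal V$ means there is $f\in\omega^\omega$ such that for every $A\subseteq\omega$, $A\in\mathcal U$ iff $f^{-1}(A)\in\mathcal V$. A P-point is a non-principal ultrafilter $\mathcal U$ on $\omega$ such that for every $\{a_n:n<\omega\}\subseteq\mathcal U$ there is $a\in\mathcal U$ with $a\setminus a_n$ finite for all $n$. A $P_{\mathfrak c}$-point is a non-principal ultrafilter $\mathcal U$ on $\omega$ such that for every $\beta<\mathfrak c$ and every $\{a_i:i<\beta\}\subseteq\mathcal U$ there is $a\in\mathcal U$ with $a\setminus a_i$ finite for all $i<\beta$. *)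

theory Defs
  imports "HOL-Analysis.Analysis"
begin

unbundle cardinal_syntax

section \<open>Ultrafilters on the natural numbers\<close>

definition filter_sets :: "'a filter \<Rightarrow> 'a set set" where
  "filter_sets \<U> = {A. \<forall>\<^sub>F x in \<U>. x \<in> A}"

definition ultrafilter :: "'a filter \<Rightarrow> bool" where
  "ultrafilter \<U> \<longleftrightarrow> \<U> \<noteq> bot \<and> (\<forall>A. A \<in> filter_sets \<U> \<or> - A \<in> filter_sets \<U>)"

definition nonprincipal :: "'a filter \<Rightarrow> bool" where
  "nonprincipal \<U> \<longleftrightarrow> (\<forall>S. \<U> \<noteq> principal S)"

definition RK_le :: "nat filter \<Rightarrow> nat filter \<Rightarrow> bool" (infix "\<le>RK" 50) where
  "\<U> \<le>RK \<V> \<longleftrightarrow> (\<exists>f :: nat \<Rightarrow> nat. \<forall>A. A \<in> filter_sets \<U> \<longleftrightarrow> f -` A \<in> filter_sets \<V>)"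

definition P_point :: "nat filter \<Rightarrow> bool" where
  "P_point \<U> \<longleftrightarrow> ultrafilter \<U> \<and> nonprincipal \<U> \<and>
     (\<forall>a :: nat \<Rightarrow> nat set. (\<forall>n. a n \<in> filter_sets \<U>) \<longrightarrow>
        (\<exists>b \<in> filter_sets \<U>. \<forall>n. finite (b - a n)))"

text \<open>
  An ordinal is given by a well-order \<open>\<beta>\<close> (in the sense of \<^const>\<open>Well_order\<close>, so reflexive on
  its field); the elements of \<^term>\<open>Field \<beta>\<close> play the role of the ordinals \<open>i < \<beta>\<close>.
  The relation \<open><o\<close> compares well-orders by order type, and every ordinal below the continuum
  is the type of a well-order on a set of reals.
\<close>

definition P_c_point :: "nat filter \<Rightarrow> bool" where
  "P_c_point \<U> \<longleftrightarrow> ultrafilter \<U> \<and> nonprincipal \<U> \<and>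
     (\<forall>\<beta> :: real rel. Well_order \<beta> \<and> \<beta> <o |UNIV :: real set| \<longrightarrow>
        (\<forall>a :: real \<Rightarrow> nat set. (\<forall>i \<in> Field \<beta>. a i \<in> filter_sets \<U>) \<longrightarrow>
           (\<exists>b \<in> filter_sets \<U>. \<forall>i \<in> Field \<beta>. finite (b - a i))))"


section \<open>Martin's axiom\<close>

text \<open>
  A poset is a carrier \<open>P\<close> with an order \<open>r\<close>; \<open>(p, q) \<in> r\<close> is read \<open>p \<le> q\<close>, so that smaller
  conditions are stronger: dense sets are dense downwards and filters are closed upwards.
\<close>

definition compatible :: "'p set \<Rightarrow> 'p rel \<Rightarrow> 'p \<Rightarrow> 'p \<Rightarrow> bool" where
  "compatible P r p q \<longleftrightarrow> (\<exists>s \<in> P. (s, p) \<in> r \<and> (s, q) \<in> r)"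

definition ccc :: "'p set \<Rightarrow> 'p rel \<Rightarrow> bool" where
  "ccc P r \<longleftrightarrow>
     (\<forall>A \<subseteq> P. (\<forall>p \<in> A. \<forall>q \<in> A. p \<noteq> q \<longrightarrow> \<not> compatible P r p q) \<longrightarrow> countable A)"

definition dense_in :: "'p set \<Rightarrow> 'p rel \<Rightarrow> 'p set \<Rightarrow> bool" where
  "dense_in P r D \<longleftrightarrow> D \<subseteq> P \<and> (\<forall>p \<in> P. \<exists>d \<in> D. (d, p) \<in> r)"

definition poset_filter :: "'p set \<Rightarrow> 'p rel \<Rightarrow> 'p set \<Rightarrow> bool" where
  "poset_filter P r G \<longleftrightarrow> G \<subseteq> P \<and> G \<noteq> {} \<and>
     (\<forall>p \<in> G. \<forall>q \<in> P. (p, q) \<in> r \<longrightarrow> q \<in> G) \<and>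
     (\<forall>p \<in> G. \<forall>q \<in> G. \<exists>s \<in> G. (s, p) \<in> r \<and> (s, q) \<in> r)"

definition MA_on :: "'p itself \<Rightarrow> 'i rel \<Rightarrow> bool" where
  "MA_on _ \<alpha> \<longleftrightarrow>
     (\<forall>(P :: 'p set) r (D :: 'i \<Rightarrow> 'p set).
        partial_order_on P r \<and> P \<noteq> {} \<and> ccc P r \<and> (\<forall>i \<in> Field \<alpha>. dense_in P r (D i)) \<longrightarrow>
        (\<exists>G. poset_filter P r G \<and> (\<forall>i \<in> Field \<alpha>. G \<inter> D i \<noteq> {})))"

text \<open>
  A formula of HOL cannot quantify over the type of the conditions. It suffices to consider posets
  of real numbers: lemma \<open>MA_imp_MA_on\<close> below shows that \<open>MA \<alpha>\<close> yields the same
  statement for posets over an arbitrary type.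
\<close>

definition MA :: "'i rel \<Rightarrow> bool" where
  "MA \<alpha> \<longleftrightarrow> MA_on TYPE(real) \<alpha>"

lemma MA_small_poset:
  fixes P :: "'p set" and \<alpha> :: "'i rel"
  assumes MA: "MA \<alpha>" and po: "partial_order_on P r" and ne: "P \<noteq> {}" and ccc: "ccc P r"
    and D: "\<And>i. i \<in> Field \<alpha> \<Longrightarrow> dense_in P r (D i)"
    and small: "|P| \<le>o |UNIV :: real set|"
  obtains G where "poset_filter P r G" "\<And>i. i \<in> Field \<alpha> \<Longrightarrow> G \<inter> D i \<noteq> {}"
proof -
  obtain h :: "'p \<Rightarrow> real" where h: "inj_on h P"
    using small card_of_ordLeq[of P "UNIV :: real set"] by auto
  have rP: "r \<subseteq> P \<times> P" "refl_on P r" "trans r" "antisym r"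
    using po by (auto simp: partial_order_on_def preorder_on_def)
  let ?P = "h ` P"
  define r' where "r' = {(h p, h q) | p q. (p, q) \<in> r}"
  have r': "(h p, h q) \<in> r' \<longleftrightarrow> (p, q) \<in> r" if "p \<in> P" "q \<in> P" for p q
  proof
    assume "(h p, h q) \<in> r'"
    then obtain p' q' where "(p', q') \<in> r" "h p = h p'" "h q = h q'" by (auto simp: r'_def)
    moreover from this have "p = p'" "q = q'"
      using rP(1) that inj_onD[OF h] by (metis mem_Sigma_iff subsetD)+
    ultimately show "(p, q) \<in> r" by simp
  qed (auto simp: r'_def)
  have "partial_order_on ?P r'"
    unfolding partial_order_on_def preorder_on_def
  proof (intro conjI)
    show "r' \<subseteq> ?P \<times> ?P" using rP(1) by (auto simp: r'_def)
    then have sub: "x \<in> ?P \<and> y \<in> ?P" if "(x, y) \<in> r'" for x y using that by auto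
    show "refl_on ?P r'" using rP(2) by (auto simp: refl_on_def r')
    show "trans r'"
    proof (rule transI)
      fix x y z assume xy: "(x, y) \<in> r'" and yz: "(y, z) \<in> r'"
      obtain p q s where "p \<in> P" "q \<in> P" "s \<in> P" "x = h p" "y = h q" "z = h s"
        using sub[OF xy] sub[OF yz] by auto
      then show "(x, z) \<in> r'" using xy yz rP(3) r' by (metis transD)
    qed
    show "antisym r'"
    proof (rule antisymI)
      fix x y assume xy: "(x, y) \<in> r'" and yx: "(y, x) \<in> r'"
      obtain p q where "p \<in> P" "q \<in> P" "x = h p" "y = h q" using sub[OF xy] by auto
      then show "x = y" using xy yx rP(4) r' by (metis antisymD)
    qed
  qed
  moreover have comp: "compatible ?P r' (h p) (h q) \<longleftrightarrow> compatible P r p q" if "p \<in> P" "q \<in> P" for p q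
    using that by (auto simp: compatible_def r')
  have "ccc ?P r'"
    unfolding ccc_def
  proof (intro allI impI)
    fix A assume A: "A \<subseteq> ?P" and anti: "\<forall>p\<in>A. \<forall>q\<in>A. p \<noteq> q \<longrightarrow> \<not> compatible ?P r' p q"
    obtain B where B: "B \<subseteq> P" "A = h ` B" using A by (auto simp: subset_image_iff)
    have "\<forall>p\<in>B. \<forall>q\<in>B. p \<noteq> q \<longrightarrow> \<not> compatible P r p q"
      using anti B comp h by (metis image_eqI inj_onD subsetD)
    then have "countable B" using ccc B(1) by (simp add: ccc_def)
    then show "countable A" by (simp add: B(2))
  qed
  moreover have "\<forall>i \<in> Field \<alpha>. dense_in ?P r' (h ` D i)"
  proof
    fix i assume "i \<in> Field \<alpha>"
    then have d: "D i \<subseteq> P" "\<forall>p\<in>P. \<exists>d\<in>D i. (d, p) \<in> r" using D by (auto simp: dense_in_def)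
    then show "dense_in ?P r' (h ` D i)"
      unfolding dense_in_def using r' by (auto simp: subset_iff)
  qed
  ultimately obtain G where G: "poset_filter ?P r' G" "\<forall>i \<in> Field \<alpha>. G \<inter> h ` D i \<noteq> {}"
    using MA[unfolded MA_def MA_on_def, rule_format, of ?P r' "\<lambda>i. h ` D i"] ne by auto
  define H where "H = {p \<in> P. h p \<in> G}"
  have GH: "G = h ` H" using G(1) by (auto simp: H_def poset_filter_def)
  have HP: "H \<subseteq> P" by (auto simp: H_def)
  show ?thesis
  proof
    have "q \<in> H" if "p \<in> H" "q \<in> P" "(p, q) \<in> r" for p q
      using G(1) that r'[of p q] by (auto simp: poset_filter_def H_def)
    moreover have "\<exists>s\<in>H. (s, p) \<in> r \<and> (s, q) \<in> r" if "p \<in> H" "q \<in> H" for p q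
    proof -
      have "\<exists>s\<in>G. (s, h p) \<in> r' \<and> (s, h q) \<in> r'"
        using G(1) that by (auto simp: poset_filter_def GH)
      then show ?thesis using that HP by (auto simp: GH r' subset_iff)
    qed
    ultimately show "poset_filter P r H"
      using HP G(1) GH by (auto simp: poset_filter_def)
    show "H \<inter> D i \<noteq> {}" if i: "i \<in> Field \<alpha>" for i
    proof -
      have "D i \<subseteq> P" using D[OF i] by (simp add: dense_in_def)
      then show ?thesis using G(2) i h HP unfolding GH
        by (metis image_is_empty inj_on_image_Int)
    qed
  qed
qed

lemma MA_imp_le_continuum:
  fixes \<alpha> :: "'i rel"
  assumes MA: "MA \<alpha>"
  shows "|Field \<alpha>| \<le>o |UNIV :: real set|"
proof (rule ccontr)
  assume "\<not> ?thesis"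
  then have "|UNIV :: real set| \<le>o |Field \<alpha>|"
    using ordLeq_total[OF card_of_Well_order card_of_Well_order, of "UNIV :: real set" "Field \<alpha>"] by blast
  then obtain g :: "real \<Rightarrow> 'i" where g: "inj g" "range g \<subseteq> Field \<alpha>"
    unfolding card_of_ordLeq[symmetric] by blast
  obtain k :: "nat set \<Rightarrow> real" where k: "inj k"
    using nat_sets_eqpoll_reals by (auto simp: eqpoll_def bij_betw_def)
  have gk: "inj (g \<circ> k)" using g k by (simp add: inj_compose)
  define r where "r = {(s, t). \<exists>u :: bool list. s = t @ u}"
  define D where "D i = {s :: bool list. \<exists>n < length s. s ! n \<noteq> (n \<in> inv (g \<circ> k) i)}" for i
  have "partial_order_on UNIV r"
    by (auto simp: partial_order_on_def preorder_on_def refl_on_def trans_def antisym_def r_def)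
  moreover have "ccc UNIV r" by (auto simp: ccc_def)
  moreover have "dense_in UNIV r (D i)" for i
    unfolding dense_in_def
  proof (intro conjI ballI)
    fix p :: "bool list"
    have "p @ [length p \<notin> inv (g \<circ> k) i] \<in> D i"
      by (auto simp: D_def intro!: exI[of _ "length p"])
    then show "\<exists>d\<in>D i. (d, p) \<in> r" by (auto simp: r_def)
  qed simp
  moreover have "|UNIV :: bool list set| \<le>o |UNIV :: real set|"
  proof -
    have "|UNIV :: bool list set| \<le>o |UNIV :: nat set|"
      unfolding card_of_ordLeq[symmetric] by (auto intro!: exI[of _ to_nat])
    also have "|UNIV :: nat set| \<le>o |UNIV :: real set|"
      unfolding card_of_ordLeq[symmetric] by (auto intro!: exI[of _ of_nat] inj_of_nat)
    finally show ?thesis .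
  qed
  ultimately obtain G where G: "poset_filter UNIV r G" "\<And>i. i \<in> Field \<alpha> \<Longrightarrow> G \<inter> D i \<noteq> {}"
    using MA_small_poset[OF MA, of UNIV r D] by auto
  define A where "A = {n. \<exists>s\<in>G. n < length s \<and> s ! n}"
  have "g (k A) \<in> Field \<alpha>" using g(2) by auto
  then obtain s where s: "s \<in> G" "s \<in> D (g (k A))" using G(2) by blast
  have "inv (g \<circ> k) (g (k A)) = A" using inv_f_f[OF gk, of A] by simp
  then obtain n where n: "n < length s" "s ! n \<noteq> (n \<in> A)" using s(2) by (auto simp: D_def)
  have "\<not> s ! n" "n \<in> A" using n s(1) by (auto simp: A_def)
  then obtain t where t: "t \<in> G" "n < length t" "t ! n" by (auto simp: A_def)
  then obtain u where "(u, s) \<in> r" "(u, t) \<in> r"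
    using G(1) s(1) unfolding poset_filter_def by blast
  then show False using n(1) t \<open>\<not> s ! n\<close> by (auto simp: r_def) (metis nth_append)
qed

lemma MA_imp_MA_on:
  fixes \<alpha> :: "'i rel"
  assumes MA: "MA \<alpha>"
  shows "MA_on TYPE('p) \<alpha>"
  unfolding MA_on_def
proof (intro allI impI, elim conjE)
  fix P :: "'p set" and r and D :: "'i \<Rightarrow> 'p set"
  assume po: "partial_order_on P r" and ne: "P \<noteq> {}" and ccc: "ccc P r"
    and D: "\<forall>i\<in>Field \<alpha>. dense_in P r (D i)"
  let ?R = "UNIV :: real set"
  have rP: "r \<subseteq> P \<times> P" "refl_on P r" "trans r" "antisym r"
    using po by (auto simp: partial_order_on_def preorder_on_def)
  obtain p0 where p0: "p0 \<in> P" using ne by auto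
  define c where "c = (\<lambda>(p, q). if compatible P r p q then SOME s. s \<in> P \<and> (s, p) \<in> r \<and> (s, q) \<in> r else p0)"
  have c: "c (p, q) \<in> P \<and> (c (p, q), p) \<in> r \<and> (c (p, q), q) \<in> r" if "compatible P r p q" for p q
  proof -
    have "\<exists>s. s \<in> P \<and> (s, p) \<in> r \<and> (s, q) \<in> r" using that by (auto simp: compatible_def)
    from someI_ex[OF this] show ?thesis using that by (simp add: c_def)
  qed
  have cP: "c x \<in> P" for x
    using c p0 by (cases x) (auto simp: c_def)
  define d where "d = (\<lambda>(i, p). SOME s. s \<in> D i \<and> (s, p) \<in> r)"
  have d: "d (i, p) \<in> D i \<and> (d (i, p), p) \<in> r" if "i \<in> Field \<alpha>" "p \<in> P" for i p
  proof -
    have "\<exists>s. s \<in> D i \<and> (s, p) \<in> r" using that D unfolding dense_in_def by blast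
    from someI_ex[OF this] show ?thesis by (simp add: d_def)
  qed
  define Q where "Q = rec_nat {p0} (\<lambda>_ X. X \<union> c ` (X \<times> X) \<union> d ` (Field \<alpha> \<times> X))"
  have Q0: "Q 0 = {p0}" and QS: "Q (Suc n) = Q n \<union> c ` (Q n \<times> Q n) \<union> d ` (Field \<alpha> \<times> Q n)" for n
    by (simp_all add: Q_def)
  have QP: "Q n \<subseteq> P" for n
  proof (induction n)
    case (Suc n)
    have "d (i, p) \<in> P" if "i \<in> Field \<alpha>" "p \<in> Q n" for i p
      using that Suc d D by (auto simp: dense_in_def subset_iff)
    then show ?case using Suc cP by (auto simp: QS)
  qed (simp add: Q0 p0)
  have mono: "Q m \<subseteq> Q n" if "m \<le> n" for m n
    using that by (rule lift_Suc_mono_le[of Q, rotated]) (auto simp: QS)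
  have infR: "infinite ?R" by (rule infinite_UNIV_char_0)
  have Qsmall: "|Q n| \<le>o |?R|" for n
  proof (induction n)
    case 0
    show ?case
      unfolding Q0 card_of_ordLeq[symmetric] by auto
  next
    case (Suc n)
    have "|Q n \<times> Q n| \<le>o |?R|" "|Field \<alpha> \<times> Q n| \<le>o |?R|"
      using Suc MA_imp_le_continuum[OF MA] infR
      by (auto intro!: card_of_Times_ordLeq_infinite_Field[of "|?R|", OF _ _ _ card_of_Card_order] simp: Field_card_of)
    then have "|c ` (Q n \<times> Q n)| \<le>o |?R|" "|d ` (Field \<alpha> \<times> Q n)| \<le>o |?R|"
      using card_of_image ordLeq_transitive by blast+
    then show ?case unfolding QS using Suc infR
      by (auto intro!: card_of_Un_ordLeq_infinite_Field[of "|?R|", OF _ _ _ card_of_Card_order]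
          simp: Field_card_of)
  qed
  define P' where "P' = (\<Union>n. Q n)"
  have P'P: "P' \<subseteq> P" using QP by (auto simp: P'_def)
  have P'small: "|P'| \<le>o |?R|"
    unfolding P'_def
  proof (rule card_of_UNION_ordLeq_infinite[OF infR])
    show "|UNIV :: nat set| \<le>o |?R|"
      unfolding card_of_ordLeq[symmetric] by (auto intro!: exI[of _ of_nat] inj_of_nat)
  qed (use Qsmall in blast)
  have cP': "c (p, q) \<in> P'" if pq: "p \<in> P'" "q \<in> P'" for p q
  proof -
    obtain m n where "p \<in> Q m" "q \<in> Q n" using pq by (auto simp: P'_def)
    then have "p \<in> Q (max m n)" "q \<in> Q (max m n)" using mono[of m "max m n"] mono[of n "max m n"] by auto
    then have "c (p, q) \<in> Q (Suc (max m n))" by (auto simp: QS)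
    then show ?thesis by (auto simp: P'_def)
  qed
  have dP': "d (i, p) \<in> P'" if ip: "i \<in> Field \<alpha>" "p \<in> P'" for i p
  proof -
    obtain m where "p \<in> Q m" using ip by (auto simp: P'_def)
    then have "d (i, p) \<in> Q (Suc m)" using ip by (auto simp: QS)
    then show ?thesis by (auto simp: P'_def)
  qed
  let ?r = "r \<inter> P' \<times> P'"
  have comp: "compatible P' ?r p q \<longleftrightarrow> compatible P r p q" if "p \<in> P'" "q \<in> P'" for p q
    using that P'P c[of p q] cP'[of p q] by (auto simp: compatible_def)
  have "partial_order_on P' ?r"
    using rP P'P by (auto simp: partial_order_on_def preorder_on_def refl_on_def trans_def antisym_def)
  moreover have "P' \<noteq> {}" using Q0 by (auto simp: P'_def)
  moreover have "ccc P' ?r"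
    unfolding ccc_def
  proof (intro allI impI)
    fix A assume A: "A \<subseteq> P'" "\<forall>p\<in>A. \<forall>q\<in>A. p \<noteq> q \<longrightarrow> \<not> compatible P' ?r p q"
    then have "A \<subseteq> P" "\<forall>p\<in>A. \<forall>q\<in>A. p \<noteq> q \<longrightarrow> \<not> compatible P r p q"
      using P'P comp by (auto simp: subset_iff)
    then show "countable A" using ccc by (simp add: ccc_def)
  qed
  moreover have "dense_in P' ?r (D i \<inter> P')" if "i \<in> Field \<alpha>" for i
    unfolding dense_in_def using that d dP' P'P
    by (auto intro!: bexI[of _ "d (i, _)"])
  ultimately obtain G where G: "poset_filter P' ?r G" "\<And>i. i \<in> Field \<alpha> \<Longrightarrow> G \<inter> (D i \<inter> P') \<noteq> {}"
    using MA_small_poset[OF MA, of P' ?r "\<lambda>i. D i \<inter> P'"] P'small by metis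
  define H where "H = {q \<in> P. \<exists>p\<in>G. (p, q) \<in> r}"
  have "G \<subseteq> H" using G(1) P'P rP(2) by (auto simp: H_def poset_filter_def refl_on_def)
  moreover have "poset_filter P r H"
    unfolding poset_filter_def
  proof (intro conjI ballI impI)
    show "H \<subseteq> P" by (auto simp: H_def)
    show "H \<noteq> {}" using \<open>G \<subseteq> H\<close> G(1) by (auto simp: poset_filter_def)
    show "q \<in> H" if "p \<in> H" "q \<in> P" "(p, q) \<in> r" for p q
      using that rP(3) by (auto simp: H_def dest: transD)
    fix p q assume "p \<in> H" "q \<in> H"
    then obtain p' q' where pq': "p' \<in> G" "q' \<in> G" "(p', p) \<in> r" "(q', q) \<in> r" by (auto simp: H_def)
    then obtain s where "s \<in> G" "(s, p') \<in> r" "(s, q') \<in> r"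
      using G(1) unfolding poset_filter_def by blast
    then show "\<exists>s\<in>H. (s, p) \<in> r \<and> (s, q) \<in> r"
      using pq' rP(3) \<open>G \<subseteq> H\<close> by (meson subsetD transD)
  qed
  ultimately show "\<exists>G. poset_filter P r G \<and> (\<forall>i\<in>Field \<alpha>. G \<inter> D i \<noteq> {})"
    using G(2) by (intro exI[of _ H]) blast
qed

end

theory Submission
  imports Defs
begin

text \<open>
  Each \<open>\<U> i\<close> is the image of \<open>\<U> zero\<close> under some \<open>f i\<close>. As \<open>\<alpha>\<close> is below the continuum and
  \<open>\<U> zero\<close> is a \<open>P\<^sub>c\<close>-point, a single set in \<open>\<U> zero\<close> makes all the \<open>f i\<close> finite-to-one.
  Martin's axiom (for Hechler forcing) then yields an interval partition of the natural numbers
  that grows so fast that almost every fibre of \<open>f i\<close>, for each \<open>i\<close>, is covered by two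
  consecutive intervals. One of the two unions of alternate intervals belongs to \<open>\<U> zero\<close>, and
  on it the index of the interval containing \<open>x\<close> depends only on \<open>f i x\<close>, up to finitely many
  \<open>x\<close>. The image of \<open>\<U> zero\<close> under the interval index is therefore below every \<open>\<U> i\<close>.
\<close>

section \<open>Domination\<close>

text \<open>Hechler forcing: a condition is a finite stem of \<open>g\<close> with a finite set
  \<open>F\<close> of indices, and stronger conditions extend the stem only by values that are at
  least \<open>h i n\<close> for all \<open>i\<close> in \<open>F\<close>.\<close>

lemma MA_dominating:
  fixes \<alpha> :: "'i rel" and h :: "'i \<Rightarrow> nat \<Rightarrow> nat"
  assumes "MA \<alpha>"
  obtains g where "\<And>i. i \<in> Field \<alpha> \<Longrightarrow> \<forall>\<^sub>F n in sequentially. h i n \<le> g n"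
proof (cases "finite (Field \<alpha>)")
  case True
  then have "\<And>i n. i \<in> Field \<alpha> \<Longrightarrow> h i n \<le> (\<Sum>j\<in>Field \<alpha>. h j n)"
    by (intro member_le_sum) auto
  then show ?thesis by (intro that[of "\<lambda>n. \<Sum>j\<in>Field \<alpha>. h j n"]) simp
next
  case False
  \<comment> \<open>Infinitely many indices leave room to attach to each \<open>e n\<close> the
    extra demand that the stem be longer than \<open>n\<close>.\<close>
  then obtain e :: "nat \<Rightarrow> 'i" where e: "inj e" "range e \<subseteq> Field \<alpha>"
    using infinite_countable_subset by blast
  define P where "P = {(s :: nat list, F :: 'i set). finite F}"
  define r where "r = {((t, G), (s, F)). (t, G) \<in> P \<and> (s, F) \<in> P \<and> F \<subseteq> G \<and> (\<exists>u. t = s @ u) \<and>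
    (\<forall>n i. length s \<le> n \<and> n < length t \<and> i \<in> F \<longrightarrow> h i n \<le> t ! n)}"
  \<comment> \<open>The bound on the length makes the generic function total without a second family of dense sets.\<close>
  define D where "D i = {(s, F). (s, F) \<in> P \<and> i \<in> F \<and> inv e i < length s}" for i
  have "partial_order_on P r"
    unfolding partial_order_on_def preorder_on_def
  proof (intro conjI)
    show "r \<subseteq> P \<times> P" by (auto simp: r_def)
    show "refl_on P r" by (auto simp: r_def refl_on_def)
    show "antisym r" by (auto simp: r_def antisym_def)
    show "trans r"
    proof (rule transI)
      fix x y z assume "(x, y) \<in> r" "(y, z) \<in> r"
      then obtain s F u G v H where xyz: "z = (s, F)" "y = (s @ u, G)" "x = (s @ u @ v, H)"
          "finite H" "finite G" "finite F" "F \<subseteq> G" "G \<subseteq> H"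
        and h1: "\<And>n i. length s \<le> n \<Longrightarrow> n < length (s @ u) \<Longrightarrow> i \<in> F \<Longrightarrow> h i n \<le> (s @ u) ! n"
        and h2: "\<And>n i. length (s @ u) \<le> n \<Longrightarrow> n < length (s @ u @ v) \<Longrightarrow> i \<in> G
          \<Longrightarrow> h i n \<le> (s @ u @ v) ! n"
        by (auto simp: r_def P_def)
      have "h i n \<le> (s @ u @ v) ! n" if "length s \<le> n" "n < length (s @ u @ v)" "i \<in> F" for n i
      proof (cases "n < length (s @ u)")
        case True
        then have "(s @ u @ v) ! n = (s @ u) ! n"
          using nth_append[of "s @ u" v n] by simp
        then show ?thesis using h1[OF that(1) True that(3)] by simp
      qed (use h2 that xyz in auto)
      then show "(x, z) \<in> r" using xyz by (auto simp: r_def P_def)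
    qed
  qed
  moreover have "ccc P r"
    unfolding ccc_def
  proof (intro allI impI)
    fix A assume A: "A \<subseteq> P" and anti: "\<forall>p\<in>A. \<forall>q\<in>A. p \<noteq> q \<longrightarrow> \<not> compatible P r p q"
    \<comment> \<open>Equal stems are compatible, so an antichain has at most one condition for each
      of the countably many stems.\<close>
    have "compatible P r (s, F) (s, G)" if "(s, F) \<in> P" "(s, G) \<in> P" for s F G
      using that unfolding compatible_def by (intro bexI[of _ "(s, F \<union> G)"]) (auto simp: r_def P_def)
    then have "inj_on fst A" using A anti by (intro inj_onI) (metis prod.collapse subsetD)
    then show "countable A" by (rule countableI')
  qed
  moreover have "P \<noteq> {}" by (auto simp: P_def)
  moreover have "dense_in P r (D i)" for i
    unfolding dense_in_def
  proof (intro conjI ballI)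
    show "D i \<subseteq> P" by (auto simp: D_def)
    fix p assume "p \<in> P"
    then obtain s F where p: "p = (s, F)" "finite F" by (auto simp: P_def)
    \<comment> \<open>Padding the stem with sums over \<open>F\<close> respects every promise in
      \<open>F\<close>; \<open>Suc\<close> makes it strictly longer than
      \<open>inv e i\<close>.\<close>
    define t where "t = s @ map (\<lambda>n. \<Sum>j\<in>F. h j n) [length s..<Suc (length s + inv e i)]"
    have t: "length t = Suc (length s + inv e i)" by (simp add: t_def)
    have "t ! n = (\<Sum>j\<in>F. h j n)" if "length s \<le> n" "n < length t" for n
      using that unfolding t by (auto simp: t_def nth_append simp del: upt_Suc)
    then have "h j n \<le> t ! n" if "length s \<le> n" "n < length t" "j \<in> F" for j n
      using that p(2) by (auto intro!: member_le_sum)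
    then have "((t, insert i F), p) \<in> r" using p by (auto simp: r_def P_def t_def)
    moreover have "(t, insert i F) \<in> D i" using p t by (auto simp: D_def P_def)
    ultimately show "\<exists>d\<in>D i. (d, p) \<in> r" by blast
  qed
  ultimately have "partial_order_on P r \<and> P \<noteq> {} \<and> ccc P r \<and> (\<forall>i\<in>Field \<alpha>. dense_in P r (D i))"
    by (intro conjI ballI)
  then have "\<exists>G. poset_filter P r G \<and> (\<forall>i\<in>Field \<alpha>. G \<inter> D i \<noteq> {})"
    by (rule MA_imp_MA_on[OF assms, unfolded MA_on_def, rule_format])
  then obtain G where G: "poset_filter P r G" and GD: "\<And>i. i \<in> Field \<alpha> \<Longrightarrow> G \<inter> D i \<noteq> {}"
    by (elim exE conjE) (erule that, erule bspec)
  have common: "\<exists>w H. (w, H) \<in> G \<and> ((w, H), (s, E)) \<in> r \<and> ((w, H), (t, F)) \<in> r"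
    if "(s, E) \<in> G" "(t, F) \<in> G" for s E t F
  proof -
    have "\<forall>p\<in>G. \<forall>q\<in>G. \<exists>x\<in>G. (x, p) \<in> r \<and> (x, q) \<in> r"
      using G unfolding poset_filter_def by (elim conjE)
    from bspec[OF bspec[OF this that(1)] that(2)]
    obtain x where x: "x \<in> G" "(x, (s, E)) \<in> r" "(x, (t, F)) \<in> r" by (elim bexE conjE)
    obtain w H where "x = (w, H)" by (cases x)
    with x show ?thesis by blast
  qed
  have agree: "w ! n = t ! n" if "((w, H), (t, F)) \<in> r" "n < length t" for w H t F n
    using that by (auto simp: r_def nth_append)
  have total: "\<exists>t F. (t, F) \<in> G \<and> n < length t" for n
  proof -
    have "G \<inter> D (e n) \<noteq> {}" using GD e(2) by blast
    then show ?thesis using inv_f_f[OF e(1)] by (auto simp: D_def)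
  qed
  \<comment> \<open>The union of the stems in \<open>G\<close>. The stem chosen is immaterial, since
    any two have a common extension in \<open>G\<close>.\<close>
  define g where "g n = (SOME k. \<exists>t F. (t, F) \<in> G \<and> n < length t \<and> k = t ! n)" for n
  have g: "\<exists>t F. (t, F) \<in> G \<and> n < length t \<and> g n = t ! n" for n
    unfolding g_def by (rule someI_ex) (use total in blast)
  show ?thesis
  proof
    fix i assume "i \<in> Field \<alpha>"
    then obtain s E where s: "(s, E) \<in> G" "i \<in> E" using GD[of i] by (auto simp: D_def)
    \<comment> \<open>The promise on \<open>i\<close> made by \<open>(s, E)\<close> binds every
      entry past \<open>s\<close> of a common extension \<open>w\<close>, and \<open>w\<close>
      agrees with \<open>g\<close> at \<open>n\<close>.\<close>
    have "h i n \<le> g n" if n: "length s \<le> n" for n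
    proof -
      obtain t F where t: "(t, F) \<in> G" "n < length t" "g n = t ! n" using g by blast
      obtain w H where w: "((w, H), (s, E)) \<in> r" "((w, H), (t, F)) \<in> r"
        using common s t by blast
      have "n < length w" using t(2) w(2) by (auto simp: r_def)
      then have "h i n \<le> w ! n" using w(1) s(2) n by (auto simp: r_def)
      then show ?thesis using agree[OF w(2)] t by simp
    qed
    then show "\<forall>\<^sub>F n in sequentially. h i n \<le> g n"
      by (auto simp: eventually_sequentially)
  qed
qed

text \<open>Otherwise \<open>Field \<alpha>\<close> could index all functions on the naturals, and a
  single \<open>g\<close> would eventually dominate them all, even \<open>Suc (g n)\<close>.
  Strictness is what \<open>P_c_point\<close> asks for.\<close>

lemma MA_imp_less_continuum:
  fixes \<alpha> :: "'i rel"
  assumes MA: "MA \<alpha>"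
  shows "|Field \<alpha>| <o |UNIV :: real set|"
proof (rule ccontr)
  assume "\<not> ?thesis"
  then have "|UNIV :: real set| \<le>o |Field \<alpha>|"
    using not_ordLess_iff_ordLeq[OF card_of_Well_order card_of_Well_order] by blast
  then obtain \<phi> :: "real \<Rightarrow> 'i" where \<phi>: "inj \<phi>" "range \<phi> \<subseteq> Field \<alpha>"
    unfolding card_of_ordLeq[symmetric] by blast
  obtain k :: "nat set \<Rightarrow> real" where k: "inj k"
    using nat_sets_eqpoll_reals by (auto simp: eqpoll_def bij_betw_def)
  \<comment> \<open>Coding functions as sets of naturals makes the injection \<open>k\<close> into
    the reals applicable.\<close>
  define graph where "graph f = range (\<lambda>n. prod_encode (n, f n))" for f :: "nat \<Rightarrow> nat"
  have "inj graph"
  proof (rule injI, rule ext)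
    fix f f' :: "nat \<Rightarrow> nat" and n assume "graph f = graph f'"
    then have "prod_encode (n, f n) \<in> graph f'" by (auto simp: graph_def)
    then show "f n = f' n" by (auto simp: graph_def)
  qed
  then have inj: "inj (\<phi> \<circ> k \<circ> graph)" using \<phi> k by (simp add: inj_compose)
  obtain g where g: "\<And>i. i \<in> Field \<alpha> \<Longrightarrow>
      \<forall>\<^sub>F n in sequentially. inv (\<phi> \<circ> k \<circ> graph) i n \<le> g n"
    using MA_dominating[OF MA] by blast
  let ?i = "(\<phi> \<circ> k \<circ> graph) (\<lambda>n. Suc (g n))"
  have "?i \<in> Field \<alpha>" using \<phi>(2) by auto
  from g[OF this] have "\<forall>\<^sub>F n in sequentially. Suc (g n) \<le> g n"
    unfolding inv_f_f[OF inj] .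
  then show False by (simp add: eventually_sequentially)
qed


section \<open>Ultrafilters\<close>

lemma filter_sets_mono: "A \<in> filter_sets F \<Longrightarrow> A \<subseteq> B \<Longrightarrow> B \<in> filter_sets F"
  by (auto simp: filter_sets_def elim: eventually_mono)

lemma filter_sets_Int: "A \<in> filter_sets F \<Longrightarrow> B \<in> filter_sets F \<Longrightarrow> A \<inter> B \<in> filter_sets F"
  by (auto simp: filter_sets_def intro: eventually_conj)

lemma filter_sets_filtermap: "A \<in> filter_sets (filtermap f F) \<longleftrightarrow> f -` A \<in> filter_sets F"
  by (simp add: filter_sets_def eventually_filtermap)

lemma empty_notin_filter_sets: "ultrafilter F \<Longrightarrow> {} \<notin> filter_sets F"
  by (auto simp: ultrafilter_def filter_sets_def trivial_limit_def)

lemma filter_sets_cong: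
  assumes "C \<in> filter_sets F" "A \<inter> C = B \<inter> C"
  shows "A \<in> filter_sets F \<longleftrightarrow> B \<in> filter_sets F"
  using assms by (metis Int_lower1 filter_sets_Int filter_sets_mono)

text \<open>A singleton \<open>{x}\<close> in \<open>F\<close> would force
  \<open>F = principal {x}\<close>, so all complements of singletons belong to
  \<open>F\<close>.\<close>

lemma nonprincipal_cofinite:
  assumes U: "ultrafilter F" and np: "nonprincipal F" and "finite S"
  shows "- S \<in> filter_sets F"
  using \<open>finite S\<close>
proof (induction S rule: finite_induct)
  case empty
  show ?case by (simp add: filter_sets_def)
next
  case (insert x S)
  have "{x} \<notin> filter_sets F"
  proof
    assume x: "{x} \<in> filter_sets F"
    have "F = principal {x}"
    proof (rule filter_eqI)
      fix Q
      have "Q x" if "eventually Q F"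
      proof (rule ccontr)
        assume "\<not> Q x"
        then have "{y. Q y} \<inter> {x} = {}" by auto
        moreover have "{y. Q y} \<in> filter_sets F" using that by (simp add: filter_sets_def)
        ultimately show False using filter_sets_Int x empty_notin_filter_sets[OF U] by metis
      qed
      moreover have "eventually Q F" if "Q x"
        using filter_sets_mono[OF x, of "{y. Q y}"] that by (simp add: filter_sets_def)
      ultimately show "eventually Q F \<longleftrightarrow> eventually Q (principal {x})"
        by (auto simp: eventually_principal)
    qed
    then show False using np by (simp add: nonprincipal_def)
  qed
  then have "- {x} \<in> filter_sets F" using U by (auto simp: ultrafilter_def)
  from filter_sets_Int[OF this insert.IH] show ?case by (rule filter_sets_mono) blast
qed

lemma P_point_pseudo_intersection:
  fixes a :: "nat \<Rightarrow> nat set"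
  assumes "P_point U" "\<And>n. a n \<in> filter_sets U"
  obtains b where "b \<in> filter_sets U" "\<And>n. finite (b - a n)"
  using assms(1)[unfolded P_point_def, THEN conjunct2, THEN conjunct2, rule_format, of a] assms(2)
  by blast

text \<open>Finite fibres keep the image nonprincipal: the complement of a point pulls back to a
  cofinite set. Pseudo-intersections are pulled back and then mapped forward.\<close>

lemma P_point_filtermap_finite_to_one:
  assumes U: "P_point U" and fin: "\<And>n. finite (f -` {n})"
  shows "P_point (filtermap f U)"
  unfolding P_point_def
proof (intro conjI allI impI)
  have uU: "ultrafilter U" and npU: "nonprincipal U" using U by (auto simp: P_point_def)
  show u: "ultrafilter (filtermap f U)"
    using uU unfolding ultrafilter_def
    by (simp add: filter_sets_filtermap vimage_Compl filtermap_bot_iff)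
  show "nonprincipal (filtermap f U)"
    unfolding nonprincipal_def
  proof (intro allI notI)
    fix S assume S: "filtermap f U = principal S"
    then have "S \<noteq> {}" using u by (auto simp: ultrafilter_def)
    then obtain x where "x \<in> S" by blast
    moreover have "- {x} \<in> filter_sets (filtermap f U)"
      using nonprincipal_cofinite[OF uU npU fin] by (simp add: filter_sets_filtermap vimage_Compl)
    ultimately show False by (auto simp: S filter_sets_def eventually_principal)
  qed
  fix a :: "nat \<Rightarrow> nat set" assume "\<forall>n. a n \<in> filter_sets (filtermap f U)"
  then have "f -` a n \<in> filter_sets U" for n by (simp add: filter_sets_filtermap)
  then obtain b where b: "b \<in> filter_sets U" "\<And>n. finite (b - f -` a n)"
    using P_point_pseudo_intersection[OF U, of "\<lambda>n. f -` a n"] by blast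
  show "\<exists>b\<in>filter_sets (filtermap f U). \<forall>n. finite (b - a n)"
  proof (intro bexI[of _ "f ` b"] allI)
    show "f ` b \<in> filter_sets (filtermap f U)"
      using filter_sets_mono[OF b(1), of "f -` f ` b"] by (auto simp: filter_sets_filtermap)
    show "finite (f ` b - a n)" for n
      by (rule finite_subset[of _ "f ` (b - f -` a n)"]) (use b(2) in auto)
  qed
qed

text \<open>A pseudo-intersection of the complements of the fibres meets each fibre in a finite
  set.\<close>

lemma P_point_finite_to_one_on:
  fixes f :: "nat \<Rightarrow> nat"
  assumes U: "P_point U" and V: "ultrafilter V" "nonprincipal V"
    and f: "\<And>A. A \<in> filter_sets V \<longleftrightarrow> f -` A \<in> filter_sets U"
  obtains A where "A \<in> filter_sets U" "\<And>n. finite (A \<inter> f -` {n})"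
proof -
  have "f -` (- {n}) \<in> filter_sets U" for n
    using nonprincipal_cofinite[OF V] f by blast
  then obtain A where "A \<in> filter_sets U" "\<And>n. finite (A - f -` (- {n}))"
    using P_point_pseudo_intersection[OF U, of "\<lambda>n. f -` (- {n})"] by blast
  then show ?thesis by (intro that) (auto simp: vimage_Compl Diff_eq)
qed

text \<open>Replaces the well-orders on reals by an arbitrary small index set, carried into the
  reals by an injection.\<close>

lemma P_c_point_pseudo_intersection:
  fixes a :: "'i \<Rightarrow> nat set"
  assumes U: "P_c_point U" and small: "|I| <o |UNIV :: real set|"
    and a: "\<And>i. i \<in> I \<Longrightarrow> a i \<in> filter_sets U"
  obtains b where "b \<in> filter_sets U" "\<And>i. i \<in> I \<Longrightarrow> finite (b - a i)"
proof -
  obtain \<phi> :: "'i \<Rightarrow> real" where \<phi>: "inj_on \<phi> I"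
    using ordLess_imp_ordLeq[OF small] unfolding card_of_ordLeq[symmetric] by blast
  have "|\<phi> ` I| <o |UNIV :: real set|"
    using card_of_image small ordLeq_ordLess_trans by blast
  moreover have "a (inv_into I \<phi> x) \<in> filter_sets U" if "x \<in> Field |\<phi> ` I|" for x
    using that a \<phi> by (auto simp: Field_card_of)
  ultimately obtain b where b: "b \<in> filter_sets U"
    "\<forall>x \<in> Field |\<phi> ` I|. finite (b - a (inv_into I \<phi> x))"
    using U[unfolded P_c_point_def, THEN conjunct2, THEN conjunct2, rule_format,
        of "|\<phi> ` I|" "\<lambda>x. a (inv_into I \<phi> x)"] card_of_Well_order[of "\<phi> ` I"] by blast
  then have "finite (b - a i)" if "i \<in> I" for i
    using that \<phi> by (auto simp: Field_card_of)
  with b(1) show ?thesis by (rule that)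
qed

text \<open>On \<open>B\<close> the map \<open>p\<close> factors through \<open>f\<close>: choose a
  preimage in \<open>B\<close> and apply \<open>p\<close>. Values off the image of \<open>B\<close>
  do not matter because \<open>B\<close> is in \<open>U\<close>.\<close>

lemma RK_le_filtermapI:
  assumes f: "\<And>A. A \<in> filter_sets V \<longleftrightarrow> f -` A \<in> filter_sets U"
    and B: "B \<in> filter_sets U"
    and factor: "\<And>x y. x \<in> B \<Longrightarrow> y \<in> B \<Longrightarrow> f x = f y \<Longrightarrow> p x = p y"
  shows "filtermap p U \<le>RK V"
  unfolding RK_le_def
proof (intro exI allI)
  fix A
  have "p (inv_into B f (f x)) = p x" if "x \<in> B" for x
    using that factor by (metis f_inv_into_f imageI inv_into_into)
  then have "p -` A \<inter> B = f -` (\<lambda>y. p (inv_into B f y)) -` A \<inter> B" by auto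
  from filter_sets_cong[OF B this]
  show "A \<in> filter_sets (filtermap p U) \<longleftrightarrow> (\<lambda>y. p (inv_into B f y)) -` A \<in> filter_sets V"
    by (simp add: f filter_sets_filtermap)
qed


section \<open>Fast interval partitions\<close>

lemma interval_partition:
  fixes g :: "nat \<Rightarrow> nat"
  obtains p :: "nat \<Rightarrow> nat" where "\<And>k. finite (p -` {k})"
    "\<And>x. \<exists>m>x. \<forall>y. y \<le> g m \<longrightarrow> p y \<le> Suc (p x)" "mono p"
proof -
  \<comment> \<open>\<open>a k\<close> is the left end of interval number \<open>k\<close>, and
    \<open>p x\<close> is the number of the interval containing \<open>x\<close>.\<close>
  define a where "a = rec_nat 0 (\<lambda>_ m. Suc (m + g m))"
  have a_Suc: "a (Suc k) = Suc (a k + g (a k))" for k by (simp add: a_def)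
  have ge: "k \<le> a k" for k
    by (induction k) (auto simp: a_Suc)
  define p where "p x = (LEAST k. x < a (Suc k))" for x
  have p: "x < a (Suc (p x))" for x
    unfolding p_def by (rule LeastI[of _ x]) (use ge[of "Suc x"] in linarith)
  have p_le: "p x \<le> k" if "x < a (Suc k)" for x k
    using that unfolding p_def by (rule Least_le)
  show ?thesis
  proof
    show "finite (p -` {k})" for k
      by (rule finite_subset[of _ "{..<a (Suc k)}"]) (use p in auto)
    show "mono p"
      by (intro monoI p_le) (use p in \<open>auto intro: le_less_trans\<close>)
    \<comment> \<open>Take for \<open>m\<close> the left end of the interval after that of
      \<open>x\<close>; that next interval extends beyond \<open>g m\<close>.\<close>
    show "\<exists>m>x. \<forall>y. y \<le> g m \<longrightarrow> p y \<le> Suc (p x)" for x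
      by (intro exI[of _ "a (Suc (p x))"] conjI p allI impI p_le) (simp add: a_Suc)
  qed
qed

section \<open>The common Rudin-Keisler lower bound\<close>

theorem theorem2p9:
  fixes \<alpha> :: "'i rel" and \<U> :: "'i \<Rightarrow> nat filter" and zero :: 'i
  assumes "Well_order \<alpha>"
    and "zero \<in> Field \<alpha>" and "\<forall>i \<in> Field \<alpha>. (zero, i) \<in> \<alpha>"
    and "MA \<alpha>"
    and "\<forall>i \<in> Field \<alpha>. P_point (\<U> i)"
    and "P_c_point (\<U> zero)"
    and "\<forall>i \<in> Field \<alpha>. \<U> i \<le>RK \<U> zero"
  shows "\<exists>\<V>. P_point \<V> \<and> (\<forall>i \<in> Field \<alpha>. \<V> \<le>RK \<U> i)"
proof -
  let ?U = "\<U> zero"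
  have U: "P_point ?U" using assms by blast
  then have uU: "ultrafilter ?U" and npU: "nonprincipal ?U" by (auto simp: P_point_def)
  obtain f where f: "\<And>i A. i \<in> Field \<alpha> \<Longrightarrow> A \<in> filter_sets (\<U> i) \<longleftrightarrow> f i -` A \<in> filter_sets ?U"
    using assms(7) unfolding RK_le_def by metis
  have "\<forall>i\<in>Field \<alpha>. \<exists>A. A \<in> filter_sets ?U \<and> (\<forall>n. finite (A \<inter> f i -` {n}))"
  proof
    fix i assume i: "i \<in> Field \<alpha>"
    have "ultrafilter (\<U> i)" "nonprincipal (\<U> i)" using assms(5) i by (auto simp: P_point_def)
    then show "\<exists>A. A \<in> filter_sets ?U \<and> (\<forall>n. finite (A \<inter> f i -` {n}))"
      using P_point_finite_to_one_on[OF U _ _ f[OF i]] by blast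
  qed
  from bchoice[OF this] obtain A where A: "\<And>i. i \<in> Field \<alpha> \<Longrightarrow> A i \<in> filter_sets ?U"
    "\<And>i n. i \<in> Field \<alpha> \<Longrightarrow> finite (A i \<inter> f i -` {n})" by blast
  obtain B where B: "B \<in> filter_sets ?U" "\<And>i. i \<in> Field \<alpha> \<Longrightarrow> finite (B - A i)"
    using P_c_point_pseudo_intersection[OF assms(6) MA_imp_less_continuum[OF assms(4)], of A] A(1)
    by blast
  have fin: "finite (B \<inter> f i -` {n})" if "i \<in> Field \<alpha>" for i n
  proof (rule finite_subset)
    show "B \<inter> f i -` {n} \<subseteq> (B - A i) \<union> (A i \<inter> f i -` {n})" by blast
    show "finite ((B - A i) \<union> (A i \<inter> f i -` {n}))" using A(2) B(2) that by blast
  qed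
  \<comment> \<open>All points of \<open>B\<close> sharing their \<open>f i\<close>-value with some
    point up to \<open>m\<close>; \<open>g\<close> will bound their maximum for almost all
    \<open>m\<close>.\<close>
  define E where "E i m = (\<Union>x\<le>m. B \<inter> f i -` {f i x})" for i m
  have finE: "finite (E i m)" if "i \<in> Field \<alpha>" for i m
    unfolding E_def by (intro finite_UN_I fin[OF that]) simp
  obtain g where g: "\<And>i. i \<in> Field \<alpha> \<Longrightarrow> \<forall>\<^sub>F n in sequentially. Max (E i n) \<le> g n"
    using MA_dominating[OF assms(4), of "\<lambda>i n. Max (E i n)"] by blast
  obtain p where p: "\<And>k. finite (p -` {k})" "mono p"
    "\<And>x. \<exists>m>x. \<forall>y. y \<le> g m \<longrightarrow> p y \<le> Suc (p x)"
    using interval_partition[of g] by metis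
  obtain b where b: "{x. even (p x) = b} \<in> filter_sets ?U"
  proof (cases "{x. even (p x)} \<in> filter_sets ?U")
    case True
    then show ?thesis using that[of True] by simp
  next
    case False
    then have "- {x. even (p x)} \<in> filter_sets ?U" using uU by (auto simp: ultrafilter_def)
    then show ?thesis using that[of False] by (simp add: Collect_neg_eq)
  qed
  have "filtermap p ?U \<le>RK \<U> i" if i: "i \<in> Field \<alpha>" for i
  proof -
    obtain N where N: "\<And>n. N \<le> n \<Longrightarrow> Max (E i n) \<le> g n"
      using g[OF i] by (auto simp: eventually_sequentially)
    \<comment> \<open>Removing the points below \<open>N\<close> makes the bound by \<open>g\<close>
      available at every \<open>m\<close> above a point of \<open>?C\<close>.\<close>
    let ?C = "B \<inter> {x. even (p x) = b} \<inter> - {..<N}"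
    have "?C \<in> filter_sets ?U"
      by (intro filter_sets_Int B b nonprincipal_cofinite[OF uU npU]) simp
    \<comment> \<open>With \<open>x\<close> the smaller point, \<open>p y\<close> is
      \<open>p x\<close> or \<open>Suc (p x)\<close>, and equal parity excludes the latter.\<close>
    moreover have eq: "p x = p y" if xy: "x \<in> ?C" "y \<in> ?C" "f i x = f i y" "x \<le> y" for x y
    proof -
      obtain m where m: "x < m" "\<And>y. y \<le> g m \<Longrightarrow> p y \<le> Suc (p x)" using p(3) by blast
      have "y \<in> E i m" using xy m by (auto simp: E_def intro!: bexI[of _ x])
      then have "y \<le> Max (E i m)" using finE[OF i] by simp
      also have "\<dots> \<le> g m" using N xy m by auto
      finally have "p y \<le> Suc (p x)" by (rule m)
      moreover have "p x \<le> p y" using xy(4) p(2) by (simp add: monoD)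
      moreover have "even (p x) \<longleftrightarrow> even (p y)" using xy by auto
      ultimately show ?thesis by (auto simp: le_Suc_eq)
    qed
    have "p x = p y" if "x \<in> ?C" "y \<in> ?C" "f i x = f i y" for x y
      using eq[of x y] eq[of y x] that by (metis nat_le_linear)
    ultimately show ?thesis by (rule RK_le_filtermapI[OF f[OF i]])
  qed
  with P_point_filtermap_finite_to_one[OF U p(1)] show ?thesis
    by (intro exI[of _ "filtermap p ?U"] conjI ballI)
qed

end
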